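(* Let $n$ be a nonnegative integer. Then the sequence $E_{n,n},E_{n,n-1},\ldots,E_{n,0}$ of Entringer numbers is log-concave.
   Context: The Entringer numbers $E_{n,k}$, $0\le k\le n$, are defined by $E_{n,0}=0$ for all $n\ge0$, $E_{1,1}=1$, and for $n\ge2$ the recurrence $E_{n,k}=\sum_{i=0}^{k-1}E_{n-1,n-1-i}$ for $1\le k\le n$. (For example, the rows $n=3,4,5$ for $k=0,\ldots,n$ are $0,1,2,2$; $0,2,4,5,5$; $0,5,10,14,16,16$.) A sequence $s_0,\ldots,s_N$ of nonnegative integers is log-concave if $s_i^2\ge s_{i-1}s_{i+1}$ for $0<i<N$. *)

theory Defs
  imports Main
begin

text \<open>The value is set to \<open>0\<close> outside the range \<open>k \<le> n\<close>. The case \<open>k = 0\<close> with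
  \<open>n \<ge> 2\<close> is covered by the empty sum.\<close>

fun entringer :: "nat \<Rightarrow> nat \<Rightarrow> nat" where
  "entringer 0 k = 0"
| "entringer (Suc 0) k = (if k = 1 then 1 else 0)"
| "entringer (Suc (Suc n)) k =
     (if k \<le> Suc (Suc n) then \<Sum>i<k. entringer (Suc n) (Suc n - i) else 0)"

lemma entringer_0_right: "entringer n 0 = 0"
  by (cases n rule: nat.exhaust; cases "n - 1") auto

lemma entringer_1_1: "entringer 1 1 = 1"
  by simp

lemma entringer_rec:
  assumes "2 \<le> n" "1 \<le> k" "k \<le> n"
  shows "entringer n k = (\<Sum>i = 0..k - 1. entringer (n - 1) (n - 1 - i))"
proof -
  obtain m where n: "n = Suc (Suc m)"
    using assms(1) by (metis Suc_le_D numeral_2_eq_2 Suc_le_mono)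
  have "{..<k} = {0..k - 1}"
    using assms(2) by auto
  then show ?thesis
    using assms(3) by (simp add: n)
qed

text \<open>Log-concavity of the finite sequence \<open>s 0, \<dots>, s N\<close>; values of \<open>s\<close> beyond \<open>N\<close> are
  irrelevant.\<close>

definition log_concave_seq :: "nat \<Rightarrow> (nat \<Rightarrow> nat) \<Rightarrow> bool" where
  "log_concave_seq N s \<longleftrightarrow> (\<forall>i. 0 < i \<and> i < N \<longrightarrow> (s i)\<^sup>2 \<ge> s (i - 1) * s (i + 1))"

end

(* By the recurrence, consecutive differences along row n + 1 are the entries of row n read
   backwards.  Rows are nondecreasing, so these differences decrease: each row is concave, and
   a nonnegative nondecreasing concave sequence is log-concave. *)
theory Submission
  imports Defs
begin

text \<open>The defining sum for \<open>Suc k\<close> extends that for \<open>k\<close> by the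
  single term \<open>i = k\<close>.\<close>

lemma entringer_Suc:
  assumes "1 \<le> n" "k \<le> n"
  shows "entringer (Suc n) (Suc k) = entringer (Suc n) k + entringer n (n - k)"
  using assms by (cases n) simp_all

lemma entringer_mono:
  assumes "j \<le> k" "k \<le> n"
  shows "entringer n j \<le> entringer n k"
  using assms
proof (induction k rule: dec_induct)
  case (step i)
  have "entringer n i \<le> entringer n (Suc i)"
  \<comment> \<open>Row 1 is an initial value, not given by the recurrence; in later rows the
    increment is a natural number.\<close>
  proof (cases "n = 1")
    case False
    with step.prems entringer_Suc[of "n - 1" i] show ?thesis
      by simp
  qed (use step.prems in simp)
  with step show ?case
    by simp
qed simp

theorem corollary7p6:
  fixes n :: nat
  shows "log_concave_seq n (\<lambda>i. entringer n (n - i))"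
  unfolding log_concave_seq_def
proof (intro allI impI)
  fix i assume i: "0 < i \<and> i < n"
  define m where "m = n - 1"
  \<comment> \<open>The sequence runs backwards, so \<open>k\<close> indexes the smallest of the
    three entries.\<close>
  define k where "k = n - (i + 1)"
  have n: "n = Suc m" and m: "1 \<le> m" "Suc k \<le> m"
    using i by (auto simp: m_def k_def)
  have idx: "n - i = Suc k" "n - (i - 1) = Suc (Suc k)" "n - (i + 1) = k"
    using i by (auto simp: k_def)
  define x where "x = entringer n k"
  define p where "p = entringer m (m - k)"
  define q where "q = entringer m (m - Suc k)"
  have "entringer n (Suc k) = x + p" "entringer n (Suc (Suc k)) = x + p + q"
    using entringer_Suc[of m k] entringer_Suc[of m "Suc k"] m
    by (simp_all add: n x_def p_def q_def del: entringer.simps)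
  moreover have "q \<le> p"
    unfolding p_def q_def by (rule entringer_mono) auto
  \<comment> \<open>The difference of the two sides is \<open>x * (p - q) + p * p\<close>.\<close>
  then have "(x + p + q) * x \<le> (x + p)\<^sup>2"
    using mult_le_mono1[of q p x] by (simp add: power2_eq_square algebra_simps trans_le_add2)
  ultimately show "entringer n (n - (i - 1)) * entringer n (n - (i + 1)) \<le> (entringer n (n - i))\<^sup>2"
    unfolding idx by (simp add: x_def del: entringer.simps)
qed

end
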